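(* If a Tychonoff space $X$ is such that $C_k(X)$ is sequentially Ascoli, then every compact-finite sequence of compact subsets of $X$ has a strongly compact-finite subsequence.
   Context: For a Tychonoff space $T$, $C_k(T)$ is the space of continuous real-valued functions on $T$ with the compact-open topology. $T$ is sequentially Ascoli if every convergent sequence $S$ in $C_k(T)$ is equicontinuous, i.e. for every $t_0\in T$ and $\varepsilon>0$ there is a neighborhood $O$ of $t_0$ with $|f(t)-f(t_0)|<\varepsilon$ for all $t\in O$ and $f\in S$. A family $\{A_i\}_{i\in I}$ of subsets of $X$ is compact-finite if for every compact $K\subseteq X$ the set $\{i\in I:K\cap A_i\neq\emptyset\}$ is finite; it is strongly compact-finite if for every $i\in I$ there is an open set $U_i\supseteq A_i$ such that $\{U_i\}_{i\in I}$ is compact-finite. *)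

theory Defs
  imports "HOL-Analysis.Analysis"
begin

text \<open>A real-valued function on the carrier of \<open>T\<close> is represented by its unique extensional
  representative, so that distinct points of the function space are distinct functions on
  \<open>topspace T\<close>.\<close>

definition cont_funs :: "'a topology \<Rightarrow> ('a \<Rightarrow> real) set" where
  "cont_funs T = {f \<in> extensional (topspace T). continuous_map T euclideanreal f}"

definition Ck :: "'a topology \<Rightarrow> ('a \<Rightarrow> real) topology" where
  "Ck T = topology_generated_by
     {{f \<in> cont_funs T. f ` K \<subseteq> U} | K U. compactin T K \<and> open U}"

lemma topspace_Ck [simp]: "topspace (Ck T) = cont_funs T"
proof -
  have "cont_funs T \<in> {{f \<in> cont_funs T. f ` K \<subseteq> U} | K U. compactin T K \<and> open U}"
    by (rule CollectI, rule exI[of _ "{}"], rule exI[of _ UNIV]) auto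
  then show ?thesis
    unfolding Ck_def topology_generated_by_topspace by blast
qed

definition equicontinuous :: "'a topology \<Rightarrow> ('a \<Rightarrow> real) set \<Rightarrow> bool" where
  "equicontinuous T S \<longleftrightarrow>
     (\<forall>t0 \<in> topspace T. \<forall>\<epsilon>>0. \<exists>N. openin T N \<and> t0 \<in> N \<and>
        (\<forall>t \<in> N. \<forall>f \<in> S. \<bar>f t - f t0\<bar> < \<epsilon>))"

text \<open>\<open>limitin\<close> constrains only a tail of the sequence to the space, hence the explicit
  requirement that all terms are continuous functions.\<close>

definition sequentially_Ascoli :: "'a topology \<Rightarrow> bool" where
  "sequentially_Ascoli T \<longleftrightarrow>
     (\<forall>s f. range s \<subseteq> topspace (Ck T) \<and> limitin (Ck T) s f sequentially
        \<longrightarrow> equicontinuous T (range s))"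

definition compact_finite :: "'a topology \<Rightarrow> 'i set \<Rightarrow> ('i \<Rightarrow> 'a set) \<Rightarrow> bool" where
  "compact_finite X I A \<longleftrightarrow>
     (\<forall>i\<in>I. A i \<subseteq> topspace X) \<and>
     (\<forall>K. compactin X K \<longrightarrow> finite {i \<in> I. K \<inter> A i \<noteq> {}})"

definition strongly_compact_finite :: "'a topology \<Rightarrow> 'i set \<Rightarrow> ('i \<Rightarrow> 'a set) \<Rightarrow> bool" where
  "strongly_compact_finite X I A \<longleftrightarrow>
     (\<exists>U. (\<forall>i\<in>I. openin X (U i) \<and> A i \<subseteq> U i) \<and> compact_finite X I U)"

end

theory Submission
  imports Defs
begin

text \<open>For nonempty compact \<open>K\<^sub>n\<close> put \<open>F\<^sub>n(f) = max 0 (min\<^bsub>K\<^sub>n\<^esub> \<bar>f\<bar> - n)\<close>, a continuous function on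
  \<open>C\<^sub>k(X)\<close>. Since the \<open>K\<^sub>n\<close> are compact-finite, every neighbourhood of the zero function contains
  some \<open>f\<close> which vanishes on a given compact set and equals \<open>n + 1\<close> on some \<open>K\<^sub>n\<close>; hence
  \<open>(F\<^sub>n)\<close> is not equicontinuous at zero and, by hypothesis, does not converge to zero. So there
  are a compact \<open>C \<subseteq> C\<^sub>k(X)\<close>, infinitely many \<open>n\<close>, and functions \<open>f\<^sub>n \<in> C\<close> with \<open>\<bar>f\<^sub>n\<bar> > n\<close> on
  \<open>K\<^sub>n\<close>. The open sets \<open>{\<bar>f\<^sub>n\<bar> > n}\<close> are compact-finite because \<open>C\<close> is uniformly bounded on
  every compact subset of \<open>X\<close>.\<close>

section \<open>Neighbourhoods and limits in the compact-open topology\<close>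

lemma openin_Ck_subbasic:
  "compactin T K \<Longrightarrow> open U \<Longrightarrow> openin (Ck T) {f \<in> cont_funs T. f ` K \<subseteq> U}"
  unfolding Ck_def by (rule topology_generated_by_Basis) blast

lemma restrict_in_cont_funs:
  "continuous_map T euclideanreal f \<Longrightarrow> restrict f (topspace T) \<in> cont_funs T"
  by (auto simp: cont_funs_def intro: continuous_map_eq)

text \<open>Membership in a subbasic set depends only on the values on one compact set; a finite
  intersection takes the union of two such sets, and a union keeps the set of one member containing
  \<open>f\<close>. Applied both to \<open>Ck X\<close> and to \<open>Ck (Ck X)\<close>.\<close>

lemma openin_Ck_imp_agreeing_on_compact:
  assumes "openin (Ck T) N" "f \<in> N"
  shows "\<exists>K. compactin T K \<and> (\<forall>g \<in> cont_funs T. (\<forall>x\<in>K. g x = f x) \<longrightarrow> g \<in> N)"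
proof -
  have "generate_topology_on {{f \<in> cont_funs T. f ` K \<subseteq> U} | K U. compactin T K \<and> open U} N"
    using assms(1) unfolding Ck_def by (rule openin_topology_generated_by)
  then show ?thesis
    using assms(2)
  proof induction
    case Empty
    then show ?case by simp
  next
    case (Int A B)
    then obtain K L where "compactin T K" "\<forall>g \<in> cont_funs T. (\<forall>x\<in>K. g x = f x) \<longrightarrow> g \<in> A"
      and "compactin T L" "\<forall>g \<in> cont_funs T. (\<forall>x\<in>L. g x = f x) \<longrightarrow> g \<in> B"
      by blast
    then show ?case
      by (intro exI[of _ "K \<union> L"]) (auto intro: compactin_Un)
  next
    case (UN \<U>)
    then obtain A where "A \<in> \<U>" "f \<in> A"
      by blast
    with UN.IH show ?case
      by (meson UnionI)
  next
    case (Basis S)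
    then obtain K U where K: "compactin T K" and S: "S = {f \<in> cont_funs T. f ` K \<subseteq> U}"
      by blast
    have "g \<in> S" if "g \<in> cont_funs T" "\<forall>x\<in>K. g x = f x" for g
      using that Basis.prems by (simp add: S image_subset_iff)
    with K show ?case
      by blast
  qed
qed

text \<open>Meant for \<open>T = Ck X\<close>: truncation makes the functionals eventually equal to
  zero on each compact set of functions, so exact agreement replaces uniform estimates.\<close>

lemma limitin_Ck_eventually_agreeing:
  assumes "f \<in> cont_funs T" "range s \<subseteq> cont_funs T"
    and "\<And>K. compactin T K \<Longrightarrow> \<forall>\<^sub>F n in F. \<forall>x\<in>K. s n x = f x"
  shows "limitin (Ck T) s f F"
  unfolding limitin_def
proof (intro conjI allI impI)
  show "f \<in> topspace (Ck T)"
    using assms(1) by simp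
next
  fix U assume "openin (Ck T) U \<and> f \<in> U"
  then obtain K where K: "compactin T K" "\<forall>g \<in> cont_funs T. (\<forall>x\<in>K. g x = f x) \<longrightarrow> g \<in> U"
    using openin_Ck_imp_agreeing_on_compact by blast
  from assms(3)[OF K(1)] show "\<forall>\<^sub>F n in F. s n \<in> U"
    by (rule eventually_mono) (use K(2) assms(2) in blast)
qed

section \<open>Minima and bounds over compact sets\<close>

lemma cont_funs_attains_Inf_abs:
  assumes "compactin T K" "K \<noteq> {}" "f \<in> cont_funs T"
  obtains x where "x \<in> K" "(INF x\<in>K. \<bar>f x\<bar>) = \<bar>f x\<bar>" "\<And>y. y \<in> K \<Longrightarrow> \<bar>f x\<bar> \<le> \<bar>f y\<bar>"
proof -
  have "continuous_map T euclideanreal (\<lambda>x. \<bar>f x\<bar>)"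
    using assms(3) by (simp add: cont_funs_def continuous_map_real_abs)
  then have "compact ((\<lambda>x. \<bar>f x\<bar>) ` K)"
    using image_compactin[OF assms(1)] compactin_euclidean_iff by blast
  then obtain x where "x \<in> K" "\<forall>y\<in>K. \<bar>f x\<bar> \<le> \<bar>f y\<bar>"
    using compact_attains_inf[of "(\<lambda>x. \<bar>f x\<bar>) ` K"] assms(2) by auto
  moreover from this have "(INF x\<in>K. \<bar>f x\<bar>) = \<bar>f x\<bar>"
    by (intro cInf_eq_minimum) auto
  ultimately show ?thesis
    using that by blast
qed

text \<open>As the infimum is a minimum, exceeding \<open>a\<close> is one subbasic condition on all
  of \<open>K\<close>, and lying below \<open>a\<close> is a union of subbasic conditions on single
  points. For empty \<open>K\<close> the map is constant.\<close>

lemma continuous_map_Ck_Inf_abs: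
  assumes "compactin T K"
  shows "continuous_map (Ck T) euclideanreal (\<lambda>f. INF x\<in>K. \<bar>f x\<bar>)"
proof (cases "K = {}")
  case False
  show ?thesis
    unfolding continuous_map_upper_lower_semicontinuous_lt
  proof (intro conjI allI)
    fix a :: real
    have "a < (INF x\<in>K. \<bar>f x\<bar>) \<longleftrightarrow> f ` K \<subseteq> {y. a < \<bar>y\<bar>}" if f: "f \<in> cont_funs T" for f
    proof -
      obtain x where "x \<in> K" "(INF x\<in>K. \<bar>f x\<bar>) = \<bar>f x\<bar>" "\<And>y. y \<in> K \<Longrightarrow> \<bar>f x\<bar> \<le> \<bar>f y\<bar>"
        by (rule cont_funs_attains_Inf_abs[OF assms False f]) blast
      then show ?thesis
        by (auto simp: image_subset_iff intro: less_le_trans)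
    qed
    then have "{f \<in> topspace (Ck T). a < (INF x\<in>K. \<bar>f x\<bar>)} = {f \<in> cont_funs T. f ` K \<subseteq> {y. a < \<bar>y\<bar>}}"
      by auto
    moreover have "open {y::real. a < \<bar>y\<bar>}"
      by (intro open_Collect_less continuous_intros)
    ultimately show "openin (Ck T) {f \<in> topspace (Ck T). a < (INF x\<in>K. \<bar>f x\<bar>)}"
      using openin_Ck_subbasic[OF assms] by simp
  next
    fix a :: real
    have "(INF x\<in>K. \<bar>f x\<bar>) < a \<longleftrightarrow> (\<exists>x\<in>K. f ` {x} \<subseteq> {y. \<bar>y\<bar> < a})" if f: "f \<in> cont_funs T" for f
    proof -
      obtain x where "x \<in> K" "(INF x\<in>K. \<bar>f x\<bar>) = \<bar>f x\<bar>" "\<And>y. y \<in> K \<Longrightarrow> \<bar>f x\<bar> \<le> \<bar>f y\<bar>"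
        by (rule cont_funs_attains_Inf_abs[OF assms False f]) blast
      then show ?thesis
        by (auto intro: le_less_trans)
    qed
    then have "{f \<in> topspace (Ck T). (INF x\<in>K. \<bar>f x\<bar>) < a}
        = (\<Union>x\<in>K. {f \<in> cont_funs T. f ` {x} \<subseteq> {y. \<bar>y\<bar> < a}})"
      by auto
    moreover have "openin (Ck T) {f \<in> cont_funs T. f ` {x} \<subseteq> {y. \<bar>y\<bar> < a}}" if "x \<in> K" for x
    proof (rule openin_Ck_subbasic)
      show "compactin T {x}"
        using that compactin_subset_topspace[OF assms] by auto
      show "open {y::real. \<bar>y\<bar> < a}"
        by (intro open_Collect_less continuous_intros)
    qed
    then have "openin (Ck T) (\<Union>x\<in>K. {f \<in> cont_funs T. f ` {x} \<subseteq> {y. \<bar>y\<bar> < a}})"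
      by blast
    ultimately show "openin (Ck T) {f \<in> topspace (Ck T). (INF x\<in>K. \<bar>f x\<bar>) < a}"
      by metis
  qed
qed simp

text \<open>The functions bounded on \<open>K\<close> by some natural number form an open cover of
  \<open>C\<close>, and a finite subcover gives one bound for all of \<open>C\<close>.\<close>

lemma compactin_Ck_bounded_on_compact:
  assumes C: "compactin (Ck T) C" and K: "compactin T K"
  obtains m :: nat where "\<And>f x. f \<in> C \<Longrightarrow> x \<in> K \<Longrightarrow> \<bar>f x\<bar> < m"
proof -
  define V where "V m = {f \<in> cont_funs T. f ` K \<subseteq> {y. \<bar>y\<bar> < real m}}" for m
  have "openin (Ck T) (V m)" for m
    unfolding V_def by (intro openin_Ck_subbasic K open_Collect_less continuous_intros)
  moreover have "C \<subseteq> \<Union> (range V)"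
  proof
    fix f assume "f \<in> C"
    then have f: "f \<in> cont_funs T"
      using compactin_subset_topspace[OF C] by auto
    then have "continuous_map T euclideanreal f"
      by (simp add: cont_funs_def)
    then have "bounded (f ` K)"
      using image_compactin[OF K] compactin_euclidean_iff compact_imp_bounded by blast
    then obtain b where "\<forall>x\<in>K. \<bar>f x\<bar> \<le> b"
      by (auto simp: bounded_iff)
    moreover obtain m :: nat where "b < m"
      using reals_Archimedean2 by blast
    ultimately show "f \<in> \<Union> (range V)"
      using f by (intro UnionI[of "V m"]) (auto simp: V_def)
  qed
  ultimately obtain \<F> where "finite \<F>" "\<F> \<subseteq> range V" "C \<subseteq> \<Union>\<F>"
    using compactinD[OF C, of "range V"] by blast
  then obtain M where M: "finite M" "C \<subseteq> (\<Union>m\<in>M. V m)"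
    by (metis finite_subset_image)
  \<comment> \<open>\<open>Max M\<close> is unspecified for empty \<open>M\<close>, but then
    \<open>C\<close> is empty as well.\<close>
  show ?thesis
  proof
    fix f x assume "f \<in> C" "x \<in> K"
    then obtain m where "m \<in> M" "\<bar>f x\<bar> < real m"
      using M(2) by (auto simp: V_def image_subset_iff)
    moreover have "m \<le> Max M"
      using M(1) \<open>m \<in> M\<close> by simp
    ultimately show "\<bar>f x\<bar> < real (Max M)"
      by linarith
  qed
qed

section \<open>Functions in a compact set that are large on infinitely many
  \<open>K n\<close>\<close>

text \<open>If some \<open>K n\<close> is empty, then \<open>INF x\<in>K n\<close> is a junk value, constant in the function; below,
  the zero function witnesses that under the negated conclusion this happens only finitely often.\<close>

lemma large_functions_in_compact_subset_of_Ck: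
  fixes K :: "nat \<Rightarrow> 'a set"
  assumes X: "completely_regular_space X" "Hausdorff_space X" and SA: "sequentially_Ascoli (Ck X)"
    and K: "\<And>n. compactin X (K n)" "compact_finite X UNIV K"
  shows "\<exists>C. compactin (Ck X) C \<and> (\<exists>\<^sub>\<infinity>n. \<exists>f\<in>C. \<forall>x\<in>K n. real n < \<bar>f x\<bar>)"
proof (rule ccontr)
  assume none: "\<not> ?thesis"
  have few: "\<forall>\<^sub>\<infinity>n. \<forall>f\<in>C. \<exists>x\<in>K n. \<bar>f x\<bar> \<le> real n" if "compactin (Ck X) C" for C
  proof -
    have "\<not> (\<exists>\<^sub>\<infinity>n. \<exists>f\<in>C. \<forall>x\<in>K n. real n < \<bar>f x\<bar>)"
      using none that by blast
    then show ?thesis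
      by (simp add: not_INFM not_less)
  qed
  define z where "z = restrict (\<lambda>_. 0::real) (topspace X)"
  have z: "z \<in> cont_funs X"
    unfolding z_def by (rule restrict_in_cont_funs) simp
  have "\<forall>\<^sub>\<infinity>n. K n \<noteq> {}"
    using few[of "{z}"] z by (auto elim: eventually_mono)
  then obtain n0 where n0: "\<And>n. n \<ge> n0 \<Longrightarrow> K n \<noteq> {}"
    by (auto simp: MOST_nat_le)
  \<comment> \<open>Cutting off at 0 makes \<open>F n\<close> vanish exactly where the infimum is at
    most \<open>n\<close>. By \<open>few\<close> this holds on any compact \<open>C\<close> for
    almost all \<open>n\<close>.\<close>
  define F where "F n = restrict (\<lambda>f. max 0 ((INF x\<in>K n. \<bar>f x\<bar>) - real n)) (cont_funs X)" for n
  have "F n \<in> cont_funs (Ck X)" for n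
    unfolding F_def topspace_Ck[of X, symmetric]
    by (intro restrict_in_cont_funs continuous_intros continuous_map_Ck_Inf_abs K)
  then have F: "range F \<subseteq> cont_funs (Ck X)"
    by blast
  define Z where "Z = restrict (\<lambda>_. 0::real) (cont_funs X)"
  have Z: "Z \<in> cont_funs (Ck X)"
    using restrict_in_cont_funs[of "Ck X" "\<lambda>_. 0"] by (simp add: Z_def)
  have F0: "F n f = 0" if n: "n \<ge> n0" and f: "f \<in> cont_funs X" and x: "x \<in> K n" "\<bar>f x\<bar> \<le> real n"
    for n f x
  proof -
    have "(INF x\<in>K n. \<bar>f x\<bar>) \<le> \<bar>f x\<bar>"
      by (rule cont_funs_attains_Inf_abs[OF K(1) n0[OF n] f]) (use x(1) in metis)
    with x(2) f show ?thesis
      by (simp add: F_def)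
  qed
  have "\<forall>\<^sub>F n in sequentially. \<forall>f\<in>C. F n f = Z f" if "compactin (Ck X) C" for C
  proof -
    have "\<forall>\<^sub>F n in sequentially. \<forall>f\<in>C. \<exists>x\<in>K n. \<bar>f x\<bar> \<le> real n"
      using few[OF that] by (simp add: cofinite_eq_sequentially)
    then show ?thesis
      using eventually_ge_at_top[of n0]
    proof eventually_elim
      case (elim n)
      have "C \<subseteq> cont_funs X"
        using compactin_subset_topspace[OF that] by simp
      with elim show ?case
        using F0 by (fastforce simp: Z_def)
    qed
  qed
  then have "limitin (Ck (Ck X)) F Z sequentially"
    by (intro limitin_Ck_eventually_agreeing F Z)
  then have "equicontinuous (Ck X) (range F)"
    using SA F by (auto simp: sequentially_Ascoli_def)
  \<comment> \<open>The tolerance 1 is the jump between \<open>F n z = 0\<close> and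
    \<open>F n h = 1\<close> found below.\<close>
  then obtain N where N: "openin (Ck X) N" "z \<in> N" "\<forall>f\<in>N. \<forall>G\<in>range F. \<bar>G f - G z\<bar> < 1"
    unfolding equicontinuous_def using z by (metis topspace_Ck zero_less_one)
  obtain L where L: "compactin X L" "\<forall>g \<in> cont_funs X. (\<forall>x\<in>L. g x = z x) \<longrightarrow> g \<in> N"
    using openin_Ck_imp_agreeing_on_compact[OF N(1,2)] by blast
  have "finite {n. L \<inter> K n \<noteq> {}}"
    using K(2) L(1) by (simp add: compact_finite_def)
  then have "\<forall>\<^sub>F n in sequentially. L \<inter> K n = {}"
    by (simp flip: cofinite_eq_sequentially add: eventually_cofinite)
  \<comment> \<open>Disjointness from \<open>L\<close> leaves the values on \<open>K n\<close> free;
    \<open>n0 \<le> n\<close> makes \<open>K n\<close> nonempty, so that the infimum is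
    genuine.\<close>
  then have "\<forall>\<^sub>F n in sequentially. L \<inter> K n = {} \<and> n0 \<le> n"
    using eventually_ge_at_top[of n0] by (rule eventually_conj)
  then obtain n where n: "L \<inter> K n = {}" "n0 \<le> n"
    by (auto simp: eventually_sequentially)
  \<comment> \<open>The zeros on \<open>L\<close> will put \<open>h\<close> into \<open>N\<close>,
    while the value \<open>n + 1\<close> on \<open>K n\<close> makes \<open>F n h\<close> exactly
    1.\<close>
  obtain g where g: "continuous_map X euclideanreal g" "g ` L \<subseteq> {0}" "g ` K n \<subseteq> {real n + 1}"
    using Urysohn_completely_regular_compact_closed_alt[OF X(1) K(1)[of n]
        compactin_imp_closedin[OF X(2) L(1)], of 0 "real n + 1"] n(1)
    by (auto simp: disjnt_def)
  define h where "h = restrict g (topspace X)"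
  have h: "h \<in> cont_funs X"
    unfolding h_def by (rule restrict_in_cont_funs[OF g(1)])
  have "\<forall>x\<in>L. h x = z x"
    using g(2) compactin_subset_topspace[OF L(1)] by (auto simp: h_def z_def)
  with L(2) h have "h \<in> N"
    by blast
  have hK: "h x = real n + 1" if "x \<in> K n" for x
    using that g(3) compactin_subset_topspace[OF K(1)[of n]] by (auto simp: h_def)
  have "F n h = 1"
    using n0[OF n(2)] hK h by (simp add: F_def)
  moreover have "F n z = 0"
  proof -
    obtain x where "x \<in> K n"
      using n0[OF n(2)] by blast
    moreover from this have "z x = 0"
      using compactin_subset_topspace[OF K(1)[of n]] by (auto simp: z_def)
    ultimately show ?thesis
      using F0[OF n(2) z] by simp
  qed
  moreover have "\<bar>F n h - F n z\<bar> < 1"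
    using N(3) \<open>h \<in> N\<close> by blast
  ultimately show False
    by simp
qed

theorem proposition5p18:
  fixes X :: "'a topology"
  assumes "completely_regular_space X" and "Hausdorff_space X"
    and "sequentially_Ascoli (Ck X)"
  shows "\<forall>K :: nat \<Rightarrow> 'a set.
           (\<forall>n. compactin X (K n)) \<and> compact_finite X UNIV K \<longrightarrow>
           (\<exists>r :: nat \<Rightarrow> nat. strict_mono r \<and> strongly_compact_finite X UNIV (K \<circ> r))"
proof (intro allI impI, elim conjE)
  fix K :: "nat \<Rightarrow> 'a set"
  assume K: "\<forall>n. compactin X (K n)" and fin: "compact_finite X UNIV K"
  obtain C where C: "compactin (Ck X) C" "\<exists>\<^sub>\<infinity>n. \<exists>f\<in>C. \<forall>x\<in>K n. real n < \<bar>f x\<bar>"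
    using large_functions_in_compact_subset_of_Ck[OF assms K[rule_format] fin] by blast
  define I where "I = {n. \<exists>f\<in>C. \<forall>x\<in>K n. real n < \<bar>f x\<bar>}"
  define r where "r = enumerate I"
  have "infinite I"
    using C(2) by (simp add: I_def INFM_iff_infinite)
  then have r: "strict_mono r" "\<And>i. r i \<in> I"
    by (auto simp: r_def strict_mono_enumerate enumerate_in_set)
  \<comment> \<open>The witnesses are indexed by the position \<open>i\<close> in the subsequence,
    but their lower bound is \<open>r i\<close>, the original index.\<close>
  then obtain f where f: "\<And>i. f i \<in> C" "\<And>i x. x \<in> K (r i) \<Longrightarrow> real (r i) < \<bar>f i x\<bar>"
    unfolding I_def mem_Collect_eq by metis
  define U where "U i = {x \<in> topspace X. real (r i) < \<bar>f i x\<bar>}" for i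
  have "openin X (U i)" for i
  proof -
    have "continuous_map X euclideanreal (\<lambda>x. \<bar>f i x\<bar>)"
      using f(1)[of i] compactin_subset_topspace[OF C(1)]
      by (auto simp: cont_funs_def intro: continuous_map_real_abs)
    then show ?thesis
      unfolding U_def continuous_map_upper_lower_semicontinuous_lt by blast
  qed
  moreover have "K (r i) \<subseteq> U i" for i
    using f(2) compactin_subset_topspace[OF K[rule_format, of "r i"]] by (auto simp: U_def)
  moreover have "finite {i. L \<inter> U i \<noteq> {}}" if L: "compactin X L" for L
  proof -
    obtain m :: nat where m: "\<And>f x. f \<in> C \<Longrightarrow> x \<in> L \<Longrightarrow> \<bar>f x\<bar> < m"
      using compactin_Ck_bounded_on_compact[OF C(1) L] by blast
    \<comment> \<open>At a common point of \<open>L\<close> and \<open>U i\<close> the value of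
      \<open>\<bar>f i x\<bar>\<close> lies between \<open>r i\<close> and \<open>m\<close>, and
      \<open>i \<le> r i\<close> since \<open>r\<close> is strictly increasing.\<close>
    have "i < m" if "x \<in> L" "x \<in> U i" for i x
    proof -
      have "real (r i) < real m"
        using m[OF f(1) that(1), of i] that(2) by (simp add: U_def)
      then show ?thesis
        using strict_mono_imp_increasing[OF r(1), of i] by simp
    qed
    then have "{i. L \<inter> U i \<noteq> {}} \<subseteq> {..<m}"
      by blast
    then show ?thesis
      using finite_subset by blast
  qed
  ultimately have "strongly_compact_finite X UNIV (K \<circ> r)"
    unfolding strongly_compact_finite_def compact_finite_def
    by (intro exI[of _ U]) (auto simp: U_def)
  with r(1) show "\<exists>r :: nat \<Rightarrow> nat. strict_mono r \<and> strongly_compact_finite X UNIV (K \<circ> r)"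
    by blast
qed

end
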